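(* Let $n,p\in\mathbb{N}$ and $A\subseteq 2^{[n]}$. Then $|C^p[A]|\le |C^p[\mathcal{I}_{|A|}]|$.
   Context: $[n]=\{1,\dots,n\}$ and $2^{[n]}$ is its power set. The simplicial ordering on $2^{[n]}$: for distinct $x,y\in 2^{[n]}$, $x<y$ if either $|x|<|y|$, or $|x|=|y|$ and $\min(x\triangle y)\in x$. For $0\le m\le 2^n$, $\mathcal{I}_m$ denotes the set of the first $m$ elements of $2^{[n]}$ in the simplicial ordering. For $A\subseteq 2^{[n]}$, $C^p[A]=\{y\in 2^{[n]}: |x\triangle y|\le p \text{ for every } x\in A\}$. *)

theory Defs
  imports Main
begin

definition cube :: "nat \<Rightarrow> nat set set" where
  "cube n = Pow {1..n}"

text \<open>The simplicial ordering, in its strict form. It is meant for finite sets only.\<close>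

definition simplicial_less :: "nat set \<Rightarrow> nat set \<Rightarrow> bool" where
  "simplicial_less x y \<longleftrightarrow>
     x \<noteq> y \<and> (card x < card y \<or> (card x = card y \<and> Min (sym_diff x y) \<in> x))"

text \<open>A point is among the first \<open>m\<close> elements of the cube iff fewer than \<open>m\<close> points precede it.\<close>

definition initial_segment :: "nat \<Rightarrow> nat \<Rightarrow> nat set set" where
  "initial_segment n m = {x \<in> cube n. card {z \<in> cube n. simplicial_less z x} < m}"

definition common_ball :: "nat \<Rightarrow> nat \<Rightarrow> nat set set \<Rightarrow> nat set set" where
  "common_ball n p A = {y \<in> cube n. \<forall>x\<in>A. card (sym_diff x y) \<le> p}"

end

theory Submission
  imports Defs Complex_Main
begin

text \<open>Replacing \<open>y\<close> by its complement turns \<open>C\<^sup>p[A]\<close> into the complement of the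
\<open>(n - p - 1)\<close>-fold neighbourhood of \<open>A\<close>, so the claim is Harper's vertex-isoperimetric theorem.
The simplicial order is induced by an additive real weight, so passing to sections preserves it.
By induction on the ground set, replacing both \<open>i\<close>-sections of a family by initial segments does
not enlarge its neighbourhood, and it lowers the total weight unless nothing changes. In a family of
minimal total weight all sections are thus initial segments; such a family is itself an initial
segment, except that it may contain some \<open>y\<close> in place of its immediate predecessor \<open>x\<close>, with
\<open>x\<close> and \<open>y\<close> complementary.\<close>

section \<open>The simplicial order as an additive weight\<close>

text \<open>The constant 2 makes cardinality decisive, since the terms \<open>(1/2)^i\<close> over a
  finite set sum to less than 2. Among sets of equal size, subtracting \<open>(1/2)^i\<close>
  favours small elements, as in comparing binary expansions.\<close>

definition unit_weight :: "nat \<Rightarrow> real" where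
  "unit_weight i = 2 - (1/2) ^ i"

definition weight :: "nat set \<Rightarrow> real" where
  "weight x = sum unit_weight x"

lemma weight_empty [simp]: "weight {} = 0"
  by (simp add: weight_def)

text \<open>The bound is the full geometric tail from \<open>k\<close>; it is strict because a
  finite set misses the far end of the tail.\<close>

lemma sum_half_powers_less:
  assumes "finite x" "\<forall>i\<in>x. k \<le> i"
  shows "(\<Sum>i\<in>x. (1/2::real) ^ i) < 2 * (1/2) ^ k"
proof -
  define n where "n = Max (insert k x)"
  have sub: "x \<subseteq> {k..n}" and kn: "k \<le> n"
    using assms by (auto simp: n_def)
  have "(\<Sum>i\<in>x. (1/2::real) ^ i) \<le> (\<Sum>i=k..n. (1/2) ^ i)"
    using sub by (intro sum_mono2) auto
  also have "(\<Sum>i=k..n. (1/2::real) ^ i) = 2 * (1/2) ^ k - (1/2) ^ n"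
    using kn by (induction n rule: dec_induct) auto
  finally show ?thesis
    by (smt (verit) zero_less_power half_gt_zero_iff)
qed

lemma weight_eq: "weight x = 2 * real (card x) - (\<Sum>i\<in>x. (1/2) ^ i)"
  by (simp add: weight_def unit_weight_def sum_subtractf)

text \<open>One extra element is worth 2, more than the subtracted powers can offset. For equal
  cardinalities, the first difference \<open>j\<close> contributes \<open>(1/2)^j\<close> to the sum
  over \<open>x\<close>, which exceeds everything that \<open>y\<close> can collect above
  \<open>j\<close>.\<close>

lemma simplicial_less_imp_weight_less:
  assumes "finite x" "finite y" "simplicial_less x y"
  shows "weight x < weight y"
proof (cases "card x < card y")
  case True
  have "(\<Sum>i\<in>y. (1/2::real) ^ i) < 2" "0 \<le> (\<Sum>i\<in>x. (1/2::real) ^ i)"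
    using sum_half_powers_less[of y 0] assms by (auto intro: sum_nonneg)
  then show ?thesis using True by (simp add: weight_eq)
next
  case False
  define j where "j = Min (sym_diff x y)"
  have c: "card x = card y" and jx: "j \<in> x" and ne: "sym_diff x y \<noteq> {}"
    using assms False by (auto simp: simplicial_less_def j_def)
  have fin: "finite (sym_diff x y)" using assms by auto
  have jy: "j \<notin> y" using Min_in[OF fin ne] jx unfolding j_def by blast
  have "i \<in> x \<longleftrightarrow> i \<in> y" if "i < j" for i
    using Min_le[OF fin, of i] that unfolding j_def by fastforce
  then have "y \<inter> {..<j} = x \<inter> {..<j}" by auto
  moreover have "y = (y \<inter> {..<j}) \<union> (y \<inter> {Suc j..})"
    using jy by auto (metis not_less_eq_eq linorder_not_less nat_less_le)
  ultimately have y: "y = (x \<inter> {..<j}) \<union> (y \<inter> {Suc j..})" by simp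
  have "(\<Sum>i\<in>y. (1/2::real) ^ i)
      = (\<Sum>i\<in>x \<inter> {..<j}. (1/2) ^ i) + (\<Sum>i\<in>y \<inter> {Suc j..}. (1/2) ^ i)"
    using assms by (subst y, subst sum.union_disjoint) auto
  also have "\<dots> < (\<Sum>i\<in>x \<inter> {..<j}. (1/2) ^ i) + (1/2) ^ j"
    using sum_half_powers_less[of "y \<inter> {Suc j..}" "Suc j"] assms by simp
  also have "\<dots> = (\<Sum>i\<in>insert j (x \<inter> {..<j}). (1/2) ^ i)"
    using assms by simp
  also have "\<dots> \<le> (\<Sum>i\<in>x. (1/2) ^ i)"
    using assms jx by (intro sum_mono2) auto
  finally show ?thesis using c by (simp add: weight_eq)
qed

lemma simplicial_less_total:
  assumes "finite x" "finite y" "x \<noteq> y"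
  shows "simplicial_less x y \<or> simplicial_less y x"
proof -
  have "Min (sym_diff x y) \<in> sym_diff x y"
    using assms by (intro Min_in) auto
  then show ?thesis
    using assms by (auto simp: simplicial_less_def Un_commute)
qed

lemma simplicial_less_iff_weight:
  assumes "finite x" "finite y"
  shows "simplicial_less x y \<longleftrightarrow> weight x < weight y"
  using assms simplicial_less_imp_weight_less simplicial_less_total
  by (metis less_asym less_irrefl)

lemma weight_inj:
  assumes "finite x" "finite y" "weight x = weight y"
  shows "x = y"
  using assms simplicial_less_imp_weight_less simplicial_less_total
  by (metis less_irrefl)

lemma weight_insert:
  "finite x \<Longrightarrow> i \<notin> x \<Longrightarrow> weight (insert i x) = weight x + unit_weight i"
  by (simp add: weight_def)

lemma weight_remove:
  "finite x \<Longrightarrow> i \<in> x \<Longrightarrow> weight (x - {i}) = weight x - unit_weight i"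
  using weight_insert[of "x - {i}" i] by (simp add: insert_absorb)

lemma unit_weight_less: "i < j \<Longrightarrow> unit_weight i < unit_weight j"
  by (simp add: unit_weight_def power_strict_decreasing)

lemma unit_weight_le: "i \<le> j \<Longrightarrow> unit_weight i \<le> unit_weight j"
  using unit_weight_less[of i j] by (cases "i = j") auto

lemma unit_weight_pos: "0 < unit_weight i"
  using power_le_one[of "1/2::real" i] by (simp add: unit_weight_def)

lemma weight_nonneg: "finite x \<Longrightarrow> 0 \<le> weight x"
  unfolding weight_def by (intro sum_nonneg less_imp_le[OF unit_weight_pos])

lemma weight_less_of_card:
  "finite x \<Longrightarrow> finite y \<Longrightarrow> card x < card y \<Longrightarrow> weight x < weight y"
  by (rule simplicial_less_imp_weight_less) (auto simp: simplicial_less_def)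

lemma weight_less_imp_card_le:
  assumes "finite x" "finite y" "weight x < weight y"
  shows "card x \<le> card y"
  using weight_less_of_card[of y x] assms by linarith

lemma weight_less_first_difference:
  assumes "finite x" "finite y" "card x = card y" "j \<in> x" "j \<notin> y"
    and "\<And>i. i < j \<Longrightarrow> i \<in> x \<longleftrightarrow> i \<in> y"
  shows "weight x < weight y"
proof (rule simplicial_less_imp_weight_less)
  have "Min (sym_diff x y) = j"
    using assms by (intro Min_eqI) (auto, (metis leI)+)
  then show "simplicial_less x y"
    using assms by (auto simp: simplicial_less_def)
qed (use assms in auto)

text \<open>If deleting the maxima reversed the order, all cardinalities would match, and the first
  difference of the truncated sets would lie below both maxima. It would then also be the first
  difference of \<open>x\<close> and \<open>y\<close>, putting \<open>y\<close> before
  \<open>x\<close>.\<close>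

lemma weight_remove_Max_mono:
  assumes fx: "finite x" "x \<noteq> {}" and fy: "finite y" "y \<noteq> {}" and less: "weight x < weight y"
  shows "weight (x - {Max x}) \<le> weight (y - {Max y})"
proof (rule ccontr)
  assume neg: "\<not> ?thesis"
  define a b where "a = Max x" and "b = Max y"
  have a: "a \<in> x" "\<And>i. i \<in> x \<Longrightarrow> i \<le> a" and b: "b \<in> y" "\<And>i. i \<in> y \<Longrightarrow> i \<le> b"
    using fx fy by (auto simp: a_def b_def)
  have gt: "weight (y - {b}) < weight (x - {a})"
    using neg by (simp add: a_def b_def)
  have "card x \<le> card y" "card (y - {b}) \<le> card (x - {a})"
    using weight_less_imp_card_le gt less fx fy by auto
  moreover have "card x = Suc (card (x - {a}))" "card y = Suc (card (y - {b}))"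
    using a b fx fy by (simp_all only: card_Suc_Diff1)
  ultimately have c: "card x = card y" and c': "card (x - {a}) = card (y - {b})" by auto
  define j where "j = Min (sym_diff (y - {b}) (x - {a}))"
  have sl: "simplicial_less (y - {b}) (x - {a})"
    using gt fx fy by (simp add: simplicial_less_iff_weight)
  have jy: "j \<in> y - {b}" and ne: "sym_diff (y - {b}) (x - {a}) \<noteq> {}"
    using sl c' by (auto simp: simplicial_less_def j_def)
  have fin: "finite (sym_diff (y - {b}) (x - {a}))" using fx fy by auto
  have jx: "j \<notin> x - {a}" using Min_in[OF fin ne] jy unfolding j_def by blast
  have agree: "i \<in> y - {b} \<longleftrightarrow> i \<in> x - {a}" if "i < j" for i
    using Min_le[OF fin, of i] that unfolding j_def by fastforce
  have jb: "j < b" using jy b(2)[of j] by auto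
  \<comment> \<open>Otherwise all of \<open>x - {a}\<close> lies below \<open>j\<close>, where the
    truncated sets agree. So \<open>y - {b}\<close> contains it together with the further element
    \<open>j\<close>, against equal size.\<close>
  have ja: "j < a"
  proof (rule ccontr)
    assume "\<not> j < a"
    have "k \<in> y - {b} - {j}" if k: "k \<in> x - {a}" for k
    proof -
      have "k < a" using k a(2)[of k] by auto
      then have "k < j" using \<open>\<not> j < a\<close> by simp
      then show ?thesis using agree[of k] k by auto
    qed
    then have "x - {a} \<subseteq> y - {b} - {j}" by blast
    then have "card (x - {a}) \<le> card (y - {b} - {j})"
      using fy by (intro card_mono) auto
    also have "\<dots> < card (y - {b})"
      using fy jy by (intro card_Diff1_less) auto
    finally show False using c' by simp
  qed
  have "weight y < weight x"
    using jy jx ja jb agree c fx fy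
    by (intro weight_less_first_difference[of y x j]) auto
  then show False using less by simp
qed

section \<open>Initial segments over a finite ground set\<close>

text \<open>Initial segments described by closure alone, without their size. The ground set is a
  parameter because the induction deletes points from it.\<close>

definition lower :: "nat set \<Rightarrow> nat set set \<Rightarrow> bool" where
  "lower S I \<longleftrightarrow> I \<subseteq> Pow S \<and> (\<forall>x\<in>I. \<forall>y\<in>Pow S. weight y < weight x \<longrightarrow> y \<in> I)"

definition segment :: "nat set \<Rightarrow> nat \<Rightarrow> nat set set" where
  "segment S m = {x \<in> Pow S. card {z \<in> Pow S. weight z < weight x} < m}"

text \<open>The comparison may be non-strict because finite sets of equal weight coincide.\<close>

lemma lowerD:
  assumes "lower S I" "finite S" "x \<in> I" "y \<subseteq> S" "weight y \<le> weight x"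
  shows "y \<in> I"
  using assms weight_inj[of x y] unfolding lower_def
  by (metis PowD PowI finite_subset order_le_less subsetD)

lemma lower_nested:
  assumes "finite S" "lower S I" "lower S J"
  shows "I \<subseteq> J \<or> J \<subseteq> I"
proof (rule ccontr)
  assume "\<not> ?thesis"
  then obtain x y where "x \<in> I" "x \<notin> J" "y \<in> J" "y \<notin> I" by auto
  moreover from this have "x \<subseteq> S" "y \<subseteq> S" using assms by (auto simp: lower_def)
  ultimately show False
    using lowerD[OF assms(2,1)] lowerD[OF assms(3,1)] by (metis linear)
qed

lemma lower_finite: "finite S \<Longrightarrow> lower S I \<Longrightarrow> finite I"
  unfolding lower_def by (meson finite_Pow_iff finite_subset)

lemma lower_subset_of_card_le:
  assumes "finite S" "lower S I" "lower S J" "card I \<le> card J"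
  shows "I \<subseteq> J"
  using lower_nested[OF assms(1-3)] card_seteq[of I J] lower_finite assms by auto

lemma lower_card_unique:
  assumes "finite S" "lower S I" "lower S J" "card I = card J"
  shows "I = J"
  using lower_subset_of_card_le[of S I J] lower_subset_of_card_le[of S J I] assms by auto

lemma lower_segment:
  assumes "finite S"
  shows "lower S (segment S m)"
proof -
  have "card {z \<in> Pow S. weight z < weight y} \<le> card {z \<in> Pow S. weight z < weight x}"
    if "weight y < weight x" for x y
    using that assms by (intro card_mono) auto
  then show ?thesis
    unfolding lower_def segment_def by (auto dest: order_le_less_trans)
qed

text \<open>The rank \<open>r\<close>, counting the lighter subsets, is a bijection from
  \<open>Pow S\<close> onto an interval of naturals starting at 0, and the segment is the preimage
  of \<open>{..<m}\<close>.\<close>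

lemma card_segment:
  assumes "finite S" "m \<le> card (Pow S)"
  shows "card (segment S m) = m"
proof -
  define r where "r x = card {z \<in> Pow S. weight z < weight x}" for x
  have mono: "r x < r y" if "x \<in> Pow S" "weight x < weight y" for x y
    unfolding r_def using that assms by (intro psubset_card_mono psubsetI) auto
  have inj: "inj_on r (Pow S)"
  proof (rule inj_onI)
    fix x y assume "x \<in> Pow S" "y \<in> Pow S" "r x = r y"
    then have "weight x = weight y"
      using mono[of x y] mono[of y x] by (metis less_irrefl linorder_neqE)
    then show "x = y"
      using weight_inj \<open>x \<in> Pow S\<close> \<open>y \<in> Pow S\<close> assms by (metis PowD finite_subset)
  qed
  have "r x < card (Pow S)" if "x \<in> Pow S" for x
    unfolding r_def using that assms by (intro psubset_card_mono) auto
  then have "r ` Pow S \<subseteq> {..<card (Pow S)}" by blast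
  then have img: "r ` Pow S = {..<card (Pow S)}"
    by (intro card_subset_eq) (auto simp: card_image[OF inj])
  have "r ` segment S m = {..<m}"
  proof
    show "r ` segment S m \<subseteq> {..<m}" by (auto simp: segment_def r_def)
    show "{..<m} \<subseteq> r ` segment S m"
    proof
      fix k assume k: "k \<in> {..<m}"
      then have "k \<in> r ` Pow S" using assms img by auto
      then obtain x where "x \<in> Pow S" "r x = k" by auto
      then show "k \<in> r ` segment S m" using k by (auto simp: segment_def r_def)
    qed
  qed
  moreover have "inj_on r (segment S m)"
    using inj by (rule inj_on_subset) (auto simp: segment_def)
  ultimately show ?thesis using card_image by fastforce
qed

text \<open>\<open>I - B\<close> and \<open>B - I\<close> have equal size, and every member of the
  second outweighs every member of the first. The strictness later forces a family of minimal weight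
  to have initial segments as sections.\<close>

lemma sum_weight_lower_less:
  assumes S: "finite S" and I: "lower S I" and B: "B \<subseteq> Pow S" "card B = card I" "B \<noteq> I"
  shows "sum weight I < sum weight B"
proof -
  have fin: "finite I" "finite B"
    using lower_finite[OF S I] B S by (auto intro: finite_subset)
  have c: "card (I - B) = card (B - I)"
    using fin B(2) by (simp add: card_Diff_subset_Int Int_commute)
  have "I - B = {} \<longleftrightarrow> B - I = {}"
    using c fin by (metis card_0_eq finite_Diff)
  then have ne: "I - B \<noteq> {}" and ne': "B - I \<noteq> {}" using B(3) by blast+
  \<comment> \<open>\<open>K\<close> separates the two differences: a member of \<open>B - I\<close>
    of weight at most \<open>K\<close> would belong to \<open>I\<close>.\<close>
  define K where "K = Max (weight ` (I - B))"
  have "K \<in> weight ` (I - B)"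
    unfolding K_def using ne fin by (intro Max_in) auto
  then obtain u where u: "u \<in> I - B" "weight u = K" by blast
  have up: "weight x \<le> K" if "x \<in> I - B" for x
    using that fin by (auto simp: K_def)
  have lo: "K < weight x" if "x \<in> B - I" for x
    using lowerD[OF I S, of u x] u that B(1) by fastforce
  have "sum weight (I - B) \<le> real (card (I - B)) * K"
    using up by (rule sum_bounded_above)
  also have "\<dots> = (\<Sum>x\<in>B - I. K)" by (simp add: c)
  also have "\<dots> < sum weight (B - I)"
    using lo fin ne' by (intro sum_strict_mono) auto
  finally have "sum weight (I - B) < sum weight (B - I)" .
  moreover have "sum weight I = sum weight (I \<inter> B) + sum weight (I - B)"
    "sum weight B = sum weight (I \<inter> B) + sum weight (B - I)"
    using sum.Int_Diff[OF fin(1), of weight B] sum.Int_Diff[OF fin(2), of weight I]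
    by (simp_all only: Int_commute)
  ultimately show ?thesis by linarith
qed

lemma sum_weight_lower_le:
  assumes "finite S" "lower S I" "B \<subseteq> Pow S" "card B = card I"
  shows "sum weight I \<le> sum weight B"
  using sum_weight_lower_less[of S I B] assms by (cases "B = I") auto

section \<open>Neighbourhoods of initial segments\<close>

text \<open>The closed Hamming neighbourhood of radius 1; \<open>sym_diff y {i}\<close> flips the
  coordinate \<open>i\<close>.\<close>

definition nbhd :: "nat set \<Rightarrow> nat set set \<Rightarrow> nat set set" where
  "nbhd S A = {y \<in> Pow S. y \<in> A \<or> (\<exists>i\<in>S. sym_diff y {i} \<in> A)}"

lemma nbhd_mono: "A \<subseteq> B \<Longrightarrow> nbhd S A \<subseteq> nbhd S B"
  by (auto simp: nbhd_def)

lemma nbhd_Un: "nbhd S (A \<union> B) = nbhd S A \<union> nbhd S B"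
  by (auto simp: nbhd_def)

lemma nbhd_subset: "nbhd S A \<subseteq> Pow S"
  by (auto simp: nbhd_def)

lemma finite_nbhd: "finite S \<Longrightarrow> finite (nbhd S A)"
  using nbhd_subset finite_subset by (metis finite_Pow_iff)

lemma sym_diff_eq_iff: "sym_diff z {i} = x \<longleftrightarrow> z = sym_diff x {i}"
  by blast

lemma sym_diff_singleton: "sym_diff y {i} = (if i \<in> y then y - {i} else insert i y)"
  by auto

text \<open>Among all one-step modifications of \<open>y\<close>, deleting the maximum has the least weight.\<close>

lemma nbhd_lower_iff:
  assumes S: "finite S" and I: "lower S I" and ne: "I \<noteq> {}"
  shows "y \<in> nbhd S I \<longleftrightarrow> y \<subseteq> S \<and> (y = {} \<or> y - {Max y} \<in> I)"
proof
  assume y: "y \<in> nbhd S I"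
  then have yS: "y \<subseteq> S" by (auto simp: nbhd_def)
  then have fin: "finite y" using S finite_subset by blast
  have "y - {Max y} \<in> I" if "y \<noteq> {}"
  proof -
    have M: "Max y \<in> y" using that fin by simp
    have "\<exists>x\<in>I. weight (y - {Max y}) \<le> weight x"
    proof (cases "y \<in> I")
      case True
      then show ?thesis using weight_remove[OF fin M] unit_weight_pos[of "Max y"]
        by (intro bexI[of _ y]) auto
    next
      case False
      then obtain i where i: "i \<in> S" "sym_diff y {i} \<in> I"
        using y by (auto simp: nbhd_def)
      have "weight (y - {Max y}) \<le> weight (sym_diff y {i})"
      proof (cases "i \<in> y")
        case True
        then show ?thesis
          using unit_weight_le[of i "Max y"] fin M
          by (simp add: sym_diff_singleton weight_remove)
      next
        case False
        then show ?thesis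
          using unit_weight_pos[of i] unit_weight_pos[of "Max y"] fin M
          by (simp add: sym_diff_singleton weight_remove weight_insert)
      qed
      then show ?thesis using i by blast
    qed
    then show ?thesis using lowerD[OF I S] yS by blast
  qed
  then show "y \<subseteq> S \<and> (y = {} \<or> y - {Max y} \<in> I)" using yS by blast
next
  assume y: "y \<subseteq> S \<and> (y = {} \<or> y - {Max y} \<in> I)"
  show "y \<in> nbhd S I"
  proof (cases "y = {}")
    case True
    obtain x where x: "x \<in> I" using ne by auto
    then have "finite x" using I S by (auto simp: lower_def intro: finite_subset)
    then have "{} \<in> I"
      using lowerD[OF I S x, of "{}"] weight_nonneg by simp
    then show ?thesis using True by (auto simp: nbhd_def)
  next
    case False
    then have "Max y \<in> y" using y S by (auto intro: Max_in finite_subset)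
    then show ?thesis using y False
      by (auto simp: nbhd_def sym_diff_singleton intro!: bexI[of _ "Max y"])
  qed
qed

text \<open>Membership of a nonempty set is decided by deleting its maximum, and this deletion is
  weakly monotone in weight.\<close>

lemma lower_nbhd:
  assumes S: "finite S" and I: "lower S I"
  shows "lower S (nbhd S I)"
proof (cases "I = {}")
  case True
  then show ?thesis by (simp add: nbhd_def lower_def)
next
  case False
  note iff = nbhd_lower_iff[OF S I False]
  show ?thesis
    unfolding lower_def
  proof (intro conjI ballI impI)
    show "nbhd S I \<subseteq> Pow S" by (rule nbhd_subset)
    fix x y assume x: "x \<in> nbhd S I" and y: "y \<in> Pow S" and less: "weight y < weight x"
    have fin: "finite x" "finite y" using x y S by (auto simp: nbhd_def intro: finite_subset)
    show "y \<in> nbhd S I"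
    proof (cases "y = {}")
      case True then show ?thesis using iff by simp
    next
      case False
      have "x \<noteq> {}" using less weight_nonneg[OF fin(2)] by auto
      then have "x - {Max x} \<in> I" using x iff by blast
      moreover have "weight (y - {Max y}) \<le> weight (x - {Max x})"
        using weight_remove_Max_mono fin False \<open>x \<noteq> {}\<close> less by blast
      ultimately have "y - {Max y} \<in> I" using lowerD[OF I S] y by blast
      then show ?thesis using iff y by blast
    qed
  qed
qed

section \<open>Sections along one coordinate\<close>

definition section0 :: "nat \<Rightarrow> nat set set \<Rightarrow> nat set set" where
  "section0 i A = {x \<in> A. i \<notin> x}"

definition section1 :: "nat \<Rightarrow> nat set set \<Rightarrow> nat set set" where
  "section1 i A = {x. i \<notin> x \<and> insert i x \<in> A}"

definition glue :: "nat \<Rightarrow> nat set set \<Rightarrow> nat set set \<Rightarrow> nat set set" where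
  "glue i B C = B \<union> insert i ` C"

lemma glue_sections: "glue i (section0 i A) (section1 i A) = A"
proof -
  have "x \<in> insert i ` {x. i \<notin> x \<and> insert i x \<in> A}" if "x \<in> A" "i \<in> x" for x
    using that by (intro image_eqI[of _ _ "x - {i}"]) (auto simp: insert_absorb)
  then show ?thesis by (auto simp: glue_def section0_def section1_def)
qed

lemma sections_glue:
  assumes "B \<subseteq> Pow (S - {i})" "C \<subseteq> Pow (S - {i})"
  shows "section0 i (glue i B C) = B" "section1 i (glue i B C) = C"
proof -
  show "section0 i (glue i B C) = B" using assms by (auto simp: glue_def section0_def)
  have "insert i x \<in> insert i ` C \<longleftrightarrow> x \<in> C" if "i \<notin> x" for x
  proof
    assume "insert i x \<in> insert i ` C"
    then obtain z where z: "z \<in> C" "insert i x = insert i z" by blast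
    moreover have "i \<notin> z" using z assms by blast
    ultimately show "x \<in> C" using that by (simp add: insert_ident)
  qed blast
  moreover have "insert i x \<notin> B" for x using assms by blast
  moreover have "i \<notin> x" if "x \<in> C" for x using that assms by blast
  ultimately show "section1 i (glue i B C) = C"
    unfolding glue_def section1_def by blast
qed

lemma sections_subset:
  assumes "A \<subseteq> Pow S"
  shows "section0 i A \<subseteq> Pow (S - {i})" "section1 i A \<subseteq> Pow (S - {i})"
  using assms by (auto simp: section0_def section1_def)

lemma sum_glue:
  fixes f :: "nat set \<Rightarrow> 'a::comm_monoid_add"
  assumes "finite S" "B \<subseteq> Pow (S - {i})" "C \<subseteq> Pow (S - {i})"
  shows "sum f (glue i B C) = sum f B + (\<Sum>x\<in>C. f (insert i x))"
proof -
  have fin: "finite B" "finite C"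
    using assms by (meson finite_Diff finite_Pow_iff finite_subset)+
  have "inj_on (insert i) C"
    using assms by (intro inj_onI) (subst (asm) insert_ident, auto)
  then have "(\<Sum>x\<in>insert i ` C. f x) = (\<Sum>x\<in>C. f (insert i x))"
    by (simp add: sum.reindex)
  moreover have "B \<inter> insert i ` C = {}" using assms by auto
  ultimately show ?thesis
    unfolding glue_def using fin by (subst sum.union_disjoint) auto
qed

lemma card_glue:
  assumes "finite S" "B \<subseteq> Pow (S - {i})" "C \<subseteq> Pow (S - {i})"
  shows "card (glue i B C) = card B + card C"
  using sum_glue[OF assms, of "\<lambda>_. 1::nat"] by simp

text \<open>The extra term depends only on the size of \<open>C\<close>, so families with equal
  section sizes are compared through the weights of their sections.\<close>

lemma weight_glue:
  assumes "finite S" "B \<subseteq> Pow (S - {i})" "C \<subseteq> Pow (S - {i})"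
  shows "sum weight (glue i B C) = sum weight B + sum weight C + real (card C) * unit_weight i"
proof -
  have "weight (insert i x) = weight x + unit_weight i" if "x \<in> C" for x
    using that assms by (intro weight_insert) (auto intro: finite_subset)
  then show ?thesis by (simp add: sum_glue[OF assms] sum.distrib)
qed

text \<open>Flipping a coordinate other than \<open>i\<close> stays within a section, while flipping
  \<open>i\<close> passes to the other section.\<close>

lemma nbhd_glue:
  assumes "i \<in> S" "B \<subseteq> Pow (S - {i})" "C \<subseteq> Pow (S - {i})"
  shows "nbhd S (glue i B C) = glue i (nbhd (S - {i}) B \<union> C) (nbhd (S - {i}) C \<union> B)"
proof -
  let ?A = "glue i B C" and ?T = "S - {i}"
  note sec = sections_glue[OF assms(2,3)]
  have B: "x \<in> ?A \<longleftrightarrow> x \<in> B" if "i \<notin> x" for x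
    using sec(1) that by (auto simp: section0_def)
  have C: "insert i x \<in> ?A \<longleftrightarrow> x \<in> C" if "i \<notin> x" for x
    using sec(2) that by (auto simp: section1_def)
  have S: "(\<exists>j\<in>S. P j) \<longleftrightarrow> P i \<or> (\<exists>j\<in>?T. P j)" for P using assms(1) by auto
  have i0: "y \<in> nbhd S ?A \<longleftrightarrow> y \<in> nbhd ?T B \<union> C" if "i \<notin> y" for y
  proof -
    have "sym_diff y {j} \<in> ?A \<longleftrightarrow> sym_diff y {j} \<in> B" if "j \<in> ?T" for j
      using that \<open>i \<notin> y\<close> by (intro B) auto
    then show ?thesis
      using that B[OF that] C[OF that] assms
      by (auto simp: nbhd_def S[of "\<lambda>j. sym_diff y {j} \<in> ?A"])
  qed
  have i1: "insert i y \<in> nbhd S ?A \<longleftrightarrow> y \<in> nbhd ?T C \<union> B" if "i \<notin> y" for y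
  proof -
    have "sym_diff (insert i y) {j} \<in> ?A \<longleftrightarrow> sym_diff y {j} \<in> C" if "j \<in> ?T" for j
    proof -
      have "sym_diff (insert i y) {j} = insert i (sym_diff y {j})" "i \<notin> sym_diff y {j}"
        using that \<open>i \<notin> y\<close> by auto
      then show ?thesis using C by metis
    qed
    moreover have "sym_diff (insert i y) {i} = y" using that by auto
    ultimately show ?thesis
      using that B[OF that] C[OF that] assms
      by (auto simp: nbhd_def S[of "\<lambda>j. sym_diff (insert i y) {j} \<in> ?A"])
  qed
  have out: "i \<notin> y" if "y \<in> nbhd ?T B \<union> C \<or> y \<in> nbhd ?T C \<union> B" for y
    using that assms nbhd_subset[of ?T] by blast
  have "section0 i (nbhd S ?A) = nbhd ?T B \<union> C" "section1 i (nbhd S ?A) = nbhd ?T C \<union> B"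
    using i0 i1 out unfolding section0_def section1_def by blast+
  then show ?thesis using glue_sections[of i "nbhd S ?A"] by simp
qed

text \<open>Two initial segments are nested, so the union on the left is just the larger of the two,
  and the union on the right is at least as large as either of its parts.\<close>

lemma card_nbhd_Un_lower_le:
  assumes T: "finite T" and I: "lower T I" and J: "lower T J"
    and D: "D \<subseteq> Pow T" and c: "card (nbhd T I) \<le> card (nbhd T B)" "card J = card D"
  shows "card (nbhd T I \<union> J) \<le> card (nbhd T B \<union> D)"
proof -
  have fin: "finite (nbhd T B \<union> D)"
    using T D finite_nbhd[OF T] by (auto intro: finite_subset[OF D])
  have "card (nbhd T B) \<le> card (nbhd T B \<union> D)" "card D \<le> card (nbhd T B \<union> D)"
    using fin by (auto intro: card_mono)
  moreover have "nbhd T I \<union> J = nbhd T I \<or> nbhd T I \<union> J = J"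
    using lower_nested[OF T lower_nbhd[OF T I] J] by auto
  ultimately show ?thesis using c by auto
qed

section \<open>The exceptional family\<close>

lemma card_nbhd_singleton:
  assumes "finite S" "y \<subseteq> S"
  shows "card (nbhd S {y}) = Suc (card S)"
proof -
  have "sym_diff y {i} \<subseteq> S" if "i \<in> S" for i using assms that by blast
  then have "nbhd S {y} = insert y ((\<lambda>i. sym_diff y {i}) ` S)"
    using assms(2) unfolding nbhd_def singleton_iff sym_diff_eq_iff by blast
  moreover have "inj_on (\<lambda>i. sym_diff y {i}) S"
    by (intro inj_onI) blast
  moreover have "y \<notin> (\<lambda>i. sym_diff y {i}) ` S" by blast
  ultimately show ?thesis using assms by (simp add: card_image)
qed

text \<open>If \<open>x \<noteq> {}\<close>, a neighbour of \<open>x\<close> can be missed by \<open>nbhd S L\<close> only if it adds an element above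
all of \<open>x\<close>. If \<open>Max S \<notin> x\<close>, exchanging \<open>Max x\<close> for \<open>Max S\<close> moves \<open>x\<close> up, hence to \<open>y\<close> or
beyond, which forces \<open>x\<close> and \<open>y\<close> to be singletons.\<close>

lemma card_nbhd_exceptional:
  assumes S: "finite S" and x: "x \<subseteq> S" and y: "y = S - x" and less: "weight x < weight y"
    and gap: "\<And>z. z \<subseteq> S \<Longrightarrow> weight x < weight z \<Longrightarrow> weight y \<le> weight z"
  defines "L \<equiv> {z \<in> Pow S. weight z < weight x}"
  shows "card (nbhd S (insert x L)) \<le> card (nbhd S (insert y L))"
proof (cases "x = {}")
  case True
  \<comment> \<open>No set weighs less than the empty set, so both families are singletons and their
    neighbourhoods have equal size.\<close>
  have "L = {}"
    using True weight_nonneg finite_subset[OF _ S] by (force simp: L_def not_less)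
  then show ?thesis using card_nbhd_singleton[OF S] x y by simp
next
  case False
  have fin: "finite x" "finite y" using x y S by (auto intro: finite_subset)
  have L: "nbhd S (insert z L) = nbhd S {z} \<union> nbhd S L" for z
    using nbhd_Un[of S "{z}" L] by simp
  define M where "M = Max S"
  have "S \<noteq> {}" using x False by blast
  then have M: "M \<in> S" "\<And>i. i \<in> S \<Longrightarrow> i \<le> M" using S by (simp_all add: M_def)
  \<comment> \<open>Exchanging \<open>j\<close> for the smaller \<open>i\<close> lowers the weight,
    and the exchanged set is a neighbour of \<open>insert i x\<close>.\<close>
  have inL: "insert i x \<in> nbhd S L" if "i \<in> S" "i \<notin> x" "j \<in> x" "i < j" for i j
  proof -
    have "insert i x - {j} \<in> L"
      using that x fin unit_weight_less[of i j]
      by (auto simp: L_def weight_remove weight_insert)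
    then show ?thesis
      using that x by (auto simp: nbhd_def sym_diff_singleton intro!: bexI[of _ j])
  qed
  have top: "insert i x \<in> nbhd S (insert y L)" if i: "i \<in> S" "i \<notin> x" for i
  proof (cases "M \<in> x")
    case True
    then show ?thesis using inL[of i M] M(2)[of i] i L by (metis UnI2 le_neq_implies_less)
  next
    case Mx: False
    define a where "a = Max x"
    have a: "a \<in> x" using fin False by (simp add: a_def)
    define x' where "x' = insert M (x - {a})"
    have aM: "a < M" using a Mx M x by (metis in_mono le_neq_implies_less)
    have "card x' = Suc (card (x - {a}))"
      unfolding x'_def using Mx fin by (intro card_insert_disjoint) auto
    then have cx': "card x' = card x" using card_Suc_Diff1[OF fin(1) a] by (simp only:)
    have "weight x < weight x'"
      using a Mx fin unit_weight_less[OF aM] by (simp add: x'_def weight_insert weight_remove)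
    moreover have "x' \<subseteq> S" using x M(1) by (auto simp: x'_def)
    ultimately have ge: "weight y \<le> weight x'" using gap by blast
    have fx': "finite x'" using fin by (simp add: x'_def)
    \<comment> \<open>\<open>y\<close> lies between \<open>x\<close> and \<open>x'\<close> in
      weight, and these two have the same size.\<close>
    have cxy: "card x = card y"
      using weight_less_imp_card_le[OF fin less] weight_less_of_card[OF fx' fin(2)] ge cx' by linarith
    define m where "m = Min (sym_diff x y)"
    \<comment> \<open>Complementary sets differ everywhere, so their first difference is
      \<open>Min S\<close>, and it lies in the lighter set \<open>x\<close>.\<close>
    have "sym_diff x y = S" using x y by blast
    then have mS: "m = Min S" by (simp add: m_def)
    have mx: "m \<in> x"
      using less cxy unfolding simplicial_less_iff_weight[OF fin, symmetric] m_def simplicial_less_def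
      by simp
    \<comment> \<open>If the exchange left \<open>m\<close> in place, \<open>x'\<close> would
      contain the first point of \<open>S\<close> and \<open>y\<close> would not, so
      \<open>x'\<close> would precede \<open>y\<close>.\<close>
    have "m = a"
    proof (rule ccontr)
      assume "m \<noteq> a"
      then have "m \<in> x'" "m \<notin> y" using mx y by (auto simp: x'_def)
      moreover have "i \<notin> S" if "i < m" for i using Min_le[OF S, of i] that mS by auto
      then have "i \<in> x' \<longleftrightarrow> i \<in> y" if "i < m" for i
        using that y \<open>x' \<subseteq> S\<close> by blast
      ultimately have "weight x' < weight y"
        using cx' cxy fx' fin by (intro weight_less_first_difference[of _ _ m]) auto
      then show False using ge by simp
    qed
    \<comment> \<open>\<open>a\<close> is at once the maximum of \<open>x\<close> and the minimum of
      \<open>S\<close>.\<close>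
    have "x = {a}"
    proof -
      have "k = a" if "k \<in> x" for k
      proof -
        have "k \<le> a" using that fin by (simp add: a_def)
        moreover have "a \<le> k" using that x S \<open>m = a\<close> mS by auto
        ultimately show ?thesis by simp
      qed
      then show ?thesis using a by blast
    qed
    \<comment> \<open>Now \<open>y\<close> is a singleton containing \<open>i\<close>, so removing
      \<open>a\<close> from \<open>insert i x\<close> gives \<open>y\<close>: the doubtful set is a
      neighbour of \<open>y\<close> itself.\<close>
    then have "card y = 1" using cxy by simp
    then obtain b where "y = {b}" by (auto simp: card_1_singleton_iff)
    moreover have "i \<in> y" using i y by simp
    ultimately have "y = {i}" by simp
    moreover have "i \<noteq> a" using i a by auto
    ultimately have "sym_diff (insert i x) {a} = y" using \<open>x = {a}\<close> by auto
    then show ?thesis using a x i unfolding nbhd_def by blast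
  qed
  \<comment> \<open>Deletions from \<open>x\<close> are lighter and lie in \<open>L\<close>, and
    \<open>x\<close> is a neighbour of such a deletion; insertions are handled by
    \<open>top\<close>.\<close>
  have "nbhd S {x} \<subseteq> nbhd S (insert y L)"
  proof
    fix z assume z: "z \<in> nbhd S {x}"
    have rem: "x - {j} \<in> L" if "j \<in> x" for j
      using that x fin unit_weight_pos[of j] by (auto simp: L_def weight_remove)
    obtain j where j: "j \<in> x" using False by auto
    have "x \<in> nbhd S L"
      using rem[OF j] j x by (auto simp: nbhd_def sym_diff_singleton intro!: bexI[of _ j])
    moreover have "z \<in> nbhd S (insert y L)" if "i \<in> S" "sym_diff z {i} = x" for i
    proof (cases "i \<in> x")
      case True
      then have "z = x - {i}" using that by auto
      then have "z \<in> L" using rem[OF True] by simp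
      then show ?thesis by (simp add: nbhd_def L_def)
    next
      case False
      then have "z = insert i x" using that by auto
      then show ?thesis using top that False by blast
    qed
    moreover have "z = x \<or> (\<exists>i\<in>S. sym_diff z {i} = x)" using z unfolding nbhd_def by blast
    ultimately show "z \<in> nbhd S (insert y L)" using L by blast
  qed
  then have "nbhd S (insert x L) \<subseteq> nbhd S (insert y L)" using L by auto
  then show ?thesis using finite_nbhd[OF S] by (rule card_mono[rotated])
qed

section \<open>The one-step vertex-isoperimetric inequality\<close>

lemma card_nbhd_lower_le:
  assumes "finite S" "A \<subseteq> Pow S" "lower S I" "card I = card A"
  shows "card (nbhd S I) \<le> card (nbhd S A)"
  using assms
proof (induction S arbitrary: A I rule: finite_psubset_induct)
  case (psubset S)
  note S = \<open>finite S\<close>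
  \<comment> \<open>The competitors have the size of \<open>A\<close> and a neighbourhood no larger
    than that of \<open>A\<close>. There are finitely many, so one of least total weight
    exists.\<close>
  define F where "F = {B. B \<subseteq> Pow S \<and> card B = card A \<and> card (nbhd S B) \<le> card (nbhd S A)}"
  have "finite F" by (rule finite_subset[of _ "Pow (Pow S)"]) (use S in \<open>auto simp: F_def\<close>)
  moreover have "A \<in> F" using psubset.prems by (auto simp: F_def)
  ultimately have "Min (sum weight ` F) \<in> sum weight ` F" by (intro Min_in) auto
  then obtain B where BF: "B \<in> F" and "sum weight B = Min (sum weight ` F)" by auto
  then have Bmin: "sum weight B \<le> sum weight C" if "C \<in> F" for C
    using that \<open>finite F\<close> by simp
  have B: "B \<subseteq> Pow S" "card B = card A" "card (nbhd S B) \<le> card (nbhd S A)"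
    using BF by (auto simp: F_def)
  \<comment> \<open>Replacing both sections of \<open>B\<close> by segments of the same sizes gives
    another competitor. Minimality of \<open>B\<close> rules out any loss of weight, so both
    sections were segments already.\<close>
  have sections: "lower (S - {i}) (section0 i B) \<and> lower (S - {i}) (section1 i B)" if i: "i \<in> S" for i
  proof -
    let ?T = "S - {i}"
    have T: "finite ?T" "?T \<subset> S" using S i by auto
    note sub = sections_subset[OF B(1), of i]
    define I0 where "I0 = segment ?T (card (section0 i B))"
    define I1 where "I1 = segment ?T (card (section1 i B))"
    have low: "lower ?T I0" "lower ?T I1"
      using lower_segment[OF T(1)] by (auto simp: I0_def I1_def)
    have c: "card I0 = card (section0 i B)" "card I1 = card (section1 i B)"
      unfolding I0_def I1_def using sub T by (auto intro!: card_segment card_mono)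
    have subI: "I0 \<subseteq> Pow ?T" "I1 \<subseteq> Pow ?T" using low by (auto simp: lower_def)
    have le: "card (nbhd ?T I0) \<le> card (nbhd ?T (section0 i B))"
      "card (nbhd ?T I1) \<le> card (nbhd ?T (section1 i B))"
      using psubset.IH[OF T(2)] sub low c by auto
    have nsub: "nbhd ?T C \<union> D \<subseteq> Pow ?T" if "D \<subseteq> Pow ?T" for C D
      using that nbhd_subset[of ?T C] by (rule Un_least[rotated])
    let ?C = "glue i I0 I1"
    have "card (nbhd S ?C) = card (nbhd ?T I0 \<union> I1) + card (nbhd ?T I1 \<union> I0)"
      by (simp add: nbhd_glue[OF i subI] card_glue[OF S nsub nsub] subI)
    also have "\<dots> \<le> card (nbhd ?T (section0 i B) \<union> section1 i B)
        + card (nbhd ?T (section1 i B) \<union> section0 i B)"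
      by (intro add_mono card_nbhd_Un_lower_le T low sub c le)
    also have "\<dots> = card (nbhd S B)"
      using nbhd_glue[OF i sub] card_glue[OF S nsub nsub] sub by (simp add: glue_sections)
    finally have "card (nbhd S ?C) \<le> card (nbhd S A)" using B by simp
    moreover have "card ?C = card A"
      using card_glue[OF S subI] card_glue[OF S sub] c B(2) by (simp add: glue_sections)
    moreover have "?C \<subseteq> Pow S" using subI i by (auto simp: glue_def)
    ultimately have "sum weight B \<le> sum weight ?C" by (intro Bmin) (simp add: F_def)
    then have "sum weight (section0 i B) + sum weight (section1 i B) \<le> sum weight I0 + sum weight I1"
      using weight_glue[OF S subI] weight_glue[OF S sub] c by (simp add: glue_sections)
    moreover have "sum weight I0 \<le> sum weight (section0 i B)" "sum weight I1 \<le> sum weight (section1 i B)"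
      using sum_weight_lower_le[OF T(1)] low sub c by auto
    ultimately have "section0 i B = I0" "section1 i B = I1"
      using sum_weight_lower_less[OF T(1) low(1) sub(1)] sum_weight_lower_less[OF T(1) low(2) sub(2)] c
      by fastforce+
    then show ?thesis using low by simp
  qed
  \<comment> \<open>If \<open>x\<close> and \<open>y\<close> agreed at \<open>i\<close>, they would
    lie on the same side of coordinate \<open>i\<close>. Dropping \<open>i\<close> keeps their
    order, so that section of \<open>B\<close>, being lower, would force \<open>x\<close> into
    \<open>B\<close>.\<close>
  have compl: "x = S - y" if x: "x \<subseteq> S" "x \<notin> B" and y: "y \<in> B" and less: "weight x < weight y" for x y
  proof -
    have yS: "y \<subseteq> S" using y B by auto
    have fin: "finite x" "finite y" using x yS S by (auto intro: finite_subset)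
    have "i \<in> x \<longleftrightarrow> i \<notin> y" if i: "i \<in> S" for i
    proof (rule ccontr)
      assume neg: "\<not> ?thesis"
      have T: "finite (S - {i})" using S by simp
      show False
      proof (cases "i \<in> x")
        case True
        then have iy: "i \<in> y" using neg by simp
        have "y - {i} \<in> section1 i B" using y iy by (auto simp: section1_def insert_absorb)
        moreover have "weight (x - {i}) \<le> weight (y - {i})"
          using fin True iy less by (simp add: weight_remove)
        ultimately have "x - {i} \<in> section1 i B"
          using lowerD[OF _ T, of "section1 i B" "y - {i}" "x - {i}"] sections[OF i] x(1) by blast
        then show False using True x by (simp add: section1_def insert_absorb)
      next
        case False
        then have "y \<in> section0 i B" using y neg by (auto simp: section0_def)
        then have "x \<in> section0 i B"
          using lowerD[OF _ T, of "section0 i B" y x] sections[OF i] x less False by auto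
        then show False using x by (simp add: section0_def)
      qed
    qed
    then show ?thesis using x yS by auto
  qed
  show ?case
  proof (cases "lower S B")
    case True
    then have "I = B" using lower_card_unique[OF S] psubset.prems B by simp
    then show ?thesis using B by simp
  next
    case False
    then obtain x y where x: "x \<subseteq> S" "x \<notin> B" and y: "y \<in> B" and less: "weight x < weight y"
      using B(1) by (auto simp: lower_def)
    define L where "L = {z \<in> Pow S. weight z < weight x}"
    have xy: "x = S - y" using compl x y less by blast
    have yS: "y \<subseteq> S" using y B by auto
    have yx: "y = S - x" using xy yS by auto
    \<comment> \<open>The only set lighter than \<open>y\<close> that \<open>B\<close> can miss is
      the complement of \<open>y\<close>, which is \<open>x\<close>. Dually, the only member of
      \<open>B\<close> heavier than \<open>x\<close> is \<open>y\<close>.\<close>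
    have below: "z \<in> B" if "z \<subseteq> S" "weight z < weight y" "z \<noteq> x" for z
      using compl[OF that(1) _ y that(2)] xy that by auto
    have above: "z = y" if "z \<in> B" "weight x < weight z" for z
      using compl[OF x that] that(1) B(1) yx by auto
    have "B = insert y L"
    proof (intro equalityI subsetI)
      fix z assume z: "z \<in> B"
      then have "z \<subseteq> S" using B by auto
      then have "weight z \<noteq> weight x"
        using weight_inj[of z x] z x S by (metis finite_subset)
      then show "z \<in> insert y L" using above[OF z] z \<open>z \<subseteq> S\<close> by (auto simp: L_def)
    next
      fix z assume "z \<in> insert y L"
      then consider "z = y" | "z \<subseteq> S" "weight z < weight x" by (auto simp: L_def)
      then show "z \<in> B"
      proof cases
        case 2
        then show ?thesis using below[of z] less by (cases "z = x") auto
      qed (use y in simp)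
    qed
    \<comment> \<open>A set strictly between \<open>x\<close> and \<open>y\<close> would be in
      \<open>B\<close> by \<open>below\<close>, and then equal to \<open>y\<close> by
      \<open>above\<close>.\<close>
    have gap: "weight y \<le> weight z" if "z \<subseteq> S" "weight x < weight z" for z
      using above[of z] below[of z] that by fastforce
    have finL: "finite L" using S by (simp add: L_def)
    have "lower S (insert x L)" using x by (auto simp: lower_def L_def)
    moreover have "card (insert x L) = card (insert y L)"
      using finL less by (simp add: L_def)
    ultimately have "I = insert x L"
      using lower_card_unique[OF S] psubset.prems B \<open>B = insert y L\<close> by simp
    then show ?thesis
      using card_nbhd_exceptional[OF S x(1) yx less gap] B(3) \<open>B = insert y L\<close>
      by (simp add: L_def)
  qed
qed

section \<open>Iterated neighbourhoods and Hamming distance\<close>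

text \<open>The sizes are compared by an inequality so that the induction can continue: after one
  step the neighbourhood of \<open>A\<close> may be strictly larger than that of
  \<open>I\<close>.\<close>

lemma card_funpow_nbhd_le:
  assumes S: "finite S"
  shows "A \<subseteq> Pow S \<Longrightarrow> lower S I \<Longrightarrow> card I \<le> card A
    \<Longrightarrow> card ((nbhd S ^^ t) I) \<le> card ((nbhd S ^^ t) A)"
proof (induction t arbitrary: A I)
  case (Suc t)
  \<comment> \<open>The segment of size \<open>card A\<close> mediates: it contains
    \<open>I\<close>, and the one-step inequality compares it with \<open>A\<close>.\<close>
  let ?J = "segment S (card A)"
  have J: "lower S ?J" "card ?J = card A"
    using lower_segment[OF S] card_segment[OF S] Suc.prems S by (auto intro: card_mono)
  have "card (nbhd S I) \<le> card (nbhd S ?J)"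
    using lower_subset_of_card_le[OF S Suc.prems(2) J(1)] J(2) Suc.prems(3)
    by (intro card_mono finite_nbhd S nbhd_mono) simp
  also have "\<dots> \<le> card (nbhd S A)"
    using card_nbhd_lower_le S Suc.prems J by blast
  finally show ?case
    using Suc.IH[OF nbhd_subset lower_nbhd[OF S Suc.prems(2)]]
    by (simp add: funpow_Suc_right del: funpow.simps)
qed simp

text \<open>A flip changes the distance to \<open>x\<close> by at most one, and flipping a
  coordinate where \<open>x\<close> and \<open>y\<close> differ lowers it by exactly one.\<close>

lemma mem_funpow_nbhd_iff:
  assumes S: "finite S" and A: "A \<subseteq> Pow S"
  shows "y \<in> (nbhd S ^^ t) A \<longleftrightarrow> y \<subseteq> S \<and> (\<exists>x\<in>A. card (sym_diff x y) \<le> t)"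
proof (induction t arbitrary: y)
  case 0
  have "x = y" if "x \<in> A" "y \<subseteq> S" "card (sym_diff x y) = 0" for x
  proof -
    \<comment> \<open>Infinite sets also have \<open>card\<close> 0, so finiteness must come
      first.\<close>
    have "finite (sym_diff x y)" using that A S by (auto intro: finite_subset)
    then have "sym_diff x y = {}" using that(3) by simp
    then show ?thesis by blast
  qed
  moreover have "sym_diff y y = {}" by blast
  ultimately show ?case using A by (metis PowD card.empty funpow_0 le_zero_eq subsetD)
next
  case (Suc t)
  have step: "(\<exists>x\<in>A. card (sym_diff x y) \<le> Suc t) \<longleftrightarrow>
      (\<exists>x\<in>A. card (sym_diff x y) \<le> t) \<or> (\<exists>i\<in>S. \<exists>x\<in>A. card (sym_diff x (sym_diff y {i})) \<le> t)"
    if y: "y \<subseteq> S"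
  proof -
    have "(\<exists>i\<in>S. card (sym_diff x (sym_diff y {i})) \<le> t)"
      if "x \<in> A" "card (sym_diff x y) = Suc t" for x
    proof -
      have "sym_diff x y \<noteq> {}" using that(2) by (metis card.empty nat.distinct(1))
      then obtain i where i: "i \<in> sym_diff x y" by blast
      have "sym_diff x (sym_diff y {i}) = sym_diff x y - {i}" using i by auto
      moreover have "i \<in> S" using i y that A by auto
      ultimately show ?thesis using that i by (intro bexI[of _ i]) (simp_all add: card_Diff_singleton del: Un_iff)
    qed
    moreover have "card (sym_diff x y) \<le> Suc t"
      if "x \<in> A" "card (sym_diff x (sym_diff y {i})) \<le> t" for x i
    proof -
      have "finite (sym_diff x (sym_diff y {i}))" using that A S y by (auto intro: finite_subset)
      then have "card (sym_diff x y) \<le> card (insert i (sym_diff x (sym_diff y {i})))"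
        by (intro card_mono) auto
      also have "\<dots> \<le> Suc (card (sym_diff x (sym_diff y {i})))" by (rule card_insert_le_m1) auto
      finally show ?thesis using that by simp
    qed
    ultimately show ?thesis by (metis le_Suc_eq)
  qed
  have "sym_diff y {i} \<subseteq> S" if "y \<subseteq> S" "i \<in> S" for i using that by auto
  moreover have "y \<in> nbhd S ((nbhd S ^^ t) A) \<longleftrightarrow> y \<subseteq> S \<and>
      (y \<in> (nbhd S ^^ t) A \<or> (\<exists>i\<in>S. sym_diff y {i} \<in> (nbhd S ^^ t) A))"
    unfolding nbhd_def[of S "(nbhd S ^^ t) A"] by simp
  ultimately show ?case
    unfolding funpow.simps comp_apply Suc.IH using step by blast
qed

section \<open>Common balls as complements of neighbourhoods\<close>

lemma card_sym_diff_complement: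
  assumes "finite S" "x \<subseteq> S" "y \<subseteq> S"
  shows "card (sym_diff x (S - y)) + card (sym_diff x y) = card S"
proof -
  have "sym_diff x (S - y) = S - sym_diff x y" "sym_diff x y \<subseteq> S" using assms by auto
  then show ?thesis
    using assms by (metis card_Diff_subset card_mono finite_subset le_add_diff_inverse2)
qed

text \<open>Distances in the cube never exceed \<open>n\<close>.\<close>

lemma common_ball_eq_cube:
  assumes "A \<subseteq> cube n" "n \<le> p"
  shows "common_ball n p A = cube n"
proof -
  have "card (sym_diff x y) \<le> p" if "x \<in> A" "y \<in> cube n" for x y
    using card_sym_diff_complement[of "{1..n}" x y] that assms by (auto simp: cube_def)
  then show ?thesis by (auto simp: common_ball_def)
qed

text \<open>The complement of \<open>y\<close> is within \<open>p\<close> of \<open>x\<close>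
  exactly when \<open>y\<close> is at distance at least \<open>n - p\<close> from \<open>x\<close>.
  Since \<open>p < n\<close>, this is the negation of distance at most \<open>n - p - 1\<close>,
  with no truncation in the subtraction.\<close>

lemma card_common_ball:
  assumes A: "A \<subseteq> cube n" and p: "p < n"
  shows "card (common_ball n p A) = 2 ^ n - card ((nbhd {1..n} ^^ (n - p - 1)) A)"
proof -
  let ?S = "{1..n}" and ?N = "(nbhd {1..n} ^^ (n - p - 1)) A"
  have iff: "y \<in> ?N \<longleftrightarrow> y \<subseteq> ?S \<and> (\<exists>x\<in>A. card (sym_diff x y) \<le> n - p - 1)" for y
    using A mem_funpow_nbhd_iff[of ?S A] by (simp add: cube_def)
  have c: "?S - y \<in> common_ball n p A \<longleftrightarrow> y \<notin> ?N" if y: "y \<subseteq> ?S" for y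
  proof -
    have "card (sym_diff x (?S - y)) \<le> p \<longleftrightarrow> \<not> card (sym_diff x y) \<le> n - p - 1" if "x \<in> A" for x
      using card_sym_diff_complement[of ?S x y] y that A p by (auto simp: cube_def)
    then show ?thesis using iff y by (auto simp: common_ball_def cube_def)
  qed
  have "common_ball n p A = (\<lambda>y. ?S - y) ` (Pow ?S - ?N)"
  proof (intro equalityI subsetI)
    fix y assume y: "y \<in> common_ball n p A"
    then have "y \<subseteq> ?S" by (auto simp: common_ball_def cube_def)
    then have "?S - (?S - y) = y" by auto
    then show "y \<in> (\<lambda>y. ?S - y) ` (Pow ?S - ?N)"
      using y c[of "?S - y"] by (intro image_eqI[of _ _ "?S - y"]) auto
  qed (use c in auto)
  moreover have "inj_on (\<lambda>y. ?S - y) (Pow ?S - ?N)" by (intro inj_onI) auto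
  ultimately have "card (common_ball n p A) = card (Pow ?S - ?N)" by (simp add: card_image)
  also have "?N \<subseteq> Pow ?S" using iff by auto
  then have "card (Pow ?S - ?N) = card (Pow ?S) - card ?N"
    by (intro card_Diff_subset) (auto intro: finite_subset)
  finally show ?thesis by (simp add: card_Pow)
qed

lemma initial_segment_eq_segment: "initial_segment n m = segment {1..n} m"
proof -
  have "simplicial_less z x \<longleftrightarrow> weight z < weight x" if "z \<in> Pow {1..n}" "x \<in> Pow {1..n}" for x z
    using that by (intro simplicial_less_iff_weight) (auto intro: finite_subset)
  then show ?thesis
    by (auto simp: initial_segment_def segment_def cube_def cong: conj_cong)
qed

theorem theorem3p3:
  fixes n p :: nat and A :: "nat set set"
  assumes "A \<subseteq> cube n"
  shows "card (common_ball n p A) \<le> card (common_ball n p (initial_segment n (card A)))"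
proof -
  let ?I = "initial_segment n (card A)"
  have A: "A \<subseteq> Pow {1..n}" using assms by (simp add: cube_def)
  have I: "lower {1..n} ?I" "card ?I = card A"
    using lower_segment card_segment[of "{1..n}" "card A"] A
    by (auto simp: initial_segment_eq_segment intro: card_mono)
  have sub: "?I \<subseteq> cube n" by (auto simp: initial_segment_def)
  show ?thesis
  proof (cases "p < n")
    case True
    \<comment> \<open>The segment has the smaller iterated neighbourhood, hence the larger common
      ball.\<close>
    then show ?thesis
      using card_funpow_nbhd_le[of "{1..n}" A ?I] A I
      by (simp add: card_common_ball[OF assms] card_common_ball[OF sub] diff_le_mono2)
  next
    case False
    then show ?thesis using common_ball_eq_cube[OF assms] common_ball_eq_cube[OF sub] by simp
  qed
qed

end
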